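(* Let $1\le t\le r$ be integers. Then \[ R(r,t)\le \begin{cases} \left\lfloor \frac{r-t}{2}\right\rfloor + 1 & \text{if } t\le r\le 3t-1,\\[2pt] 2r-5t+2 & \text{if } 3t\le r\le \frac{26t}{7},\\[2pt] \left\lfloor \frac{9r-14t}{8}\right\rfloor + 2 & \text{if } \frac{26t}{7}\le r\le 5t-2,\\[2pt] \left\lfloor \frac{15r-44t}{8}\right\rfloor + 3 & \text{if } 5t-1\le r\le \frac{52t-13}{9}. \end{cases} \]
   Context: All hypergraphs are finite. An $r$-uniform hypergraph $\mathcal H$ is $r$-partite if its vertex set can be partitioned as $V(\mathcal H)=P_1\sqcup\dots\sqcup P_r$ such that $|e\cap P_j|=1$ for every edge $e$ and every $j\in[r]$. It is $t$-intersecting if $|e\cap f|\ge t$ for all $e,f\in E(\mathcal H)$. An $(r,t)$-graph is an $r$-uniform, $r$-partite, $t$-intersecting hypergraph. A cover of $\mathcal H$ is a set $C\subseteq V(\mathcal H)$ with $C\cap e\neq\emptyset$ for every edge $e$; the cover number $\tau(\mathcal H)$ is the minimum size of a cover. $R(r,t)$ denotes the maximum of $\tau(\mathcal H)$ over all $(r,t)$-graphs $\mathcal H$. *)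

theory Defs
  imports Complex_Main "HOL-Library.Disjoint_Sets"
begin

definition hypergraph :: "'a set \<Rightarrow> 'a set set \<Rightarrow> bool" where
  "hypergraph V E \<longleftrightarrow> finite V \<and> E \<subseteq> Pow V"

definition uniform :: "nat \<Rightarrow> 'a set set \<Rightarrow> bool" where
  "uniform r E \<longleftrightarrow> (\<forall>e\<in>E. card e = r)"

(* Parts are allowed to be empty; this only matters when there are no edges. *)
definition partite :: "nat \<Rightarrow> 'a set \<Rightarrow> 'a set set \<Rightarrow> bool" where
  "partite r V E \<longleftrightarrow>
     (\<exists>P :: nat \<Rightarrow> 'a set.
        V = (\<Union>j\<in>{1..r}. P j) \<and> disjoint_family_on P {1..r} \<and>
        (\<forall>e\<in>E. \<forall>j\<in>{1..r}. card (e \<inter> P j) = 1))"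

definition t_intersecting :: "nat \<Rightarrow> 'a set set \<Rightarrow> bool" where
  "t_intersecting t E \<longleftrightarrow> (\<forall>e\<in>E. \<forall>f\<in>E. card (e \<inter> f) \<ge> t)"

definition rt_graph :: "nat \<Rightarrow> nat \<Rightarrow> 'a set \<Rightarrow> 'a set set \<Rightarrow> bool" where
  "rt_graph r t V E \<longleftrightarrow>
     hypergraph V E \<and> uniform r E \<and> partite r V E \<and> t_intersecting t E"

definition cover :: "'a set \<Rightarrow> 'a set set \<Rightarrow> 'a set \<Rightarrow> bool" where
  "cover V E C \<longleftrightarrow> C \<subseteq> V \<and> (\<forall>e\<in>E. C \<inter> e \<noteq> {})"

definition cover_number :: "'a set \<Rightarrow> 'a set set \<Rightarrow> nat" where
  "cover_number V E = Min {card C | C. cover V E C}"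

(* A definition cannot range over all vertex types. Every finite hypergraph has an isomorphic copy
   with vertices in nat, so hypergraphs on nat suffice; cover_number_le_R below confirms this. *)
definition R :: "nat \<Rightarrow> nat \<Rightarrow> nat" where
  "R r t = Max {cover_number V E | (V :: nat set) E. rt_graph r t V E}"

lemma finite_cover_cards:
  assumes "finite V"
  shows "finite {card C | C. cover V E C}"
proof -
  have "{card C | C. cover V E C} \<subseteq> card ` Pow V"
    by (auto simp: cover_def)
  then show ?thesis
    using assms by (meson finite_Pow_iff finite_imageI finite_subset)
qed

lemma cover_number_le_card:
  assumes "finite V" "cover V E C"
  shows "cover_number V E \<le> card C"
  unfolding cover_number_def using finite_cover_cards[OF assms(1)] assms(2)
  by (intro Min_le) auto

lemma cover_number_attained:
  assumes "finite V" "cover V E C"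
  obtains D where "cover V E D" "cover_number V E = card D"
proof -
  have "cover_number V E \<in> {card C | C. cover V E C}"
    unfolding cover_number_def using finite_cover_cards[OF assms(1)] assms(2)
    by (intro Min_in) auto
  then show ?thesis using that by auto
qed

lemma rt_graph_cover:
  assumes "rt_graph r t V E" "1 \<le> t"
  obtains C where "cover V E C" "card C \<le> r"
proof (cases "E = {}")
  case True
  then show ?thesis by (intro that[of "{}"]) (auto simp: cover_def)
next
  case False
  then obtain e where e: "e \<in> E" by auto
  have un: "card e = r" "e \<subseteq> V"
    using assms(1) e by (auto simp: rt_graph_def uniform_def hypergraph_def)
  have "e \<inter> f \<noteq> {}" if "f \<in> E" for f
  proof -
    have "t \<le> card (e \<inter> f)"
      using assms(1) e that by (auto simp: rt_graph_def t_intersecting_def)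
    with assms(2) show ?thesis by auto
  qed
  then show ?thesis using un by (intro that[of e]) (auto simp: cover_def)
qed

lemma finite_cover_numbers:
  assumes "1 \<le> t"
  shows "finite {cover_number V E | (V :: 'a set) E. rt_graph r t V E}"
proof (rule finite_subset)
  show "{cover_number V E | (V :: 'a set) E. rt_graph r t V E} \<subseteq> {..r}"
  proof clarsimp
    fix V :: "'a set" and E
    assume H: "rt_graph r t V E"
    then obtain C where "cover V E C" "card C \<le> r"
      using rt_graph_cover assms by blast
    then show "cover_number V E \<le> r"
      using H cover_number_le_card[of V E C] by (auto simp: rt_graph_def hypergraph_def)
  qed
qed simp

lemma R_attained:
  assumes "1 \<le> t"
  obtains V :: "nat set" and E where "rt_graph r t V E" "R r t = cover_number V E"
proof -
  have "rt_graph r t ({} :: nat set) {}"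
    by (auto simp: rt_graph_def hypergraph_def uniform_def t_intersecting_def partite_def
        disjoint_family_on_def intro!: exI[of _ "\<lambda>_. {}"])
  then have "R r t \<in> {cover_number V E | (V :: nat set) E. rt_graph r t V E}"
    unfolding R_def using finite_cover_numbers[OF assms] by (intro Max_in) blast+
  then show ?thesis using that by blast
qed

lemma rt_graph_image:
  assumes H: "rt_graph r t V E" and g: "inj_on g V"
  shows "rt_graph r t (g ` V) ((`) g ` E)"
proof -
  have sub: "e \<subseteq> V" if "e \<in> E" for e
    using H that by (auto simp: rt_graph_def hypergraph_def)
  have card_img: "card (g ` A) = card A" if "A \<subseteq> V" for A
    using g that by (meson card_image inj_on_subset)
  have Int_img: "g ` A \<inter> g ` B = g ` (A \<inter> B)" if "A \<subseteq> V" "B \<subseteq> V" for A B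
    using inj_on_image_Int[OF g that] by simp
  obtain P where P: "V = (\<Union>j\<in>{1..r}. P j)" "disjoint_family_on P {1..r}"
      "\<And>e j. e \<in> E \<Longrightarrow> j \<in> {1..r} \<Longrightarrow> card (e \<inter> P j) = 1"
    using H by (auto simp: rt_graph_def partite_def)
  have PV: "P j \<subseteq> V" if "j \<in> {1..r}" for j
    using P(1) that by blast
  have "partite r (g ` V) ((`) g ` E)"
    unfolding partite_def
  proof (intro exI[of _ "\<lambda>j. g ` P j"] conjI ballI)
    show "g ` V = (\<Union>j\<in>{1..r}. g ` P j)"
      by (subst P(1)) (rule image_UN)
    show "disjoint_family_on (\<lambda>j. g ` P j) {1..r}"
      using P(2) PV by (simp add: disjoint_family_on_def Int_img)
    fix e' j assume "e' \<in> (`) g ` E" and j: "j \<in> {1..r}"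
    then obtain e where e: "e \<in> E" "e' = g ` e" by auto
    have "e \<inter> P j \<subseteq> V" using sub[OF e(1)] by auto
    then show "card (e' \<inter> g ` P j) = 1"
      using P(3)[OF e(1) j] Int_img[OF sub[OF e(1)] PV[OF j]] card_img e(2) by simp
  qed
  moreover have "t_intersecting t ((`) g ` E)"
    unfolding t_intersecting_def
  proof clarify
    fix e f assume ef: "e \<in> E" "f \<in> E"
    have "e \<inter> f \<subseteq> V" using sub[OF ef(1)] by auto
    then show "t \<le> card (g ` e \<inter> g ` f)"
      using Int_img[OF sub[OF ef(1)] sub[OF ef(2)]] card_img H ef
      by (simp add: rt_graph_def t_intersecting_def)
  qed
  ultimately show ?thesis
    using H sub card_img by (auto simp: rt_graph_def hypergraph_def uniform_def)
qed

lemma cover_number_image_ge: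
  assumes H: "rt_graph r t V E" "1 \<le> t" and g: "inj_on g V"
  shows "cover_number V E \<le> cover_number (g ` V) ((`) g ` E)"
proof -
  have H': "rt_graph r t (g ` V) ((`) g ` E)"
    using rt_graph_image[OF H(1) g] .
  have fin: "finite V" "finite (g ` V)" and sub: "E \<subseteq> Pow V"
    using H by (auto simp: rt_graph_def hypergraph_def)
  obtain C where "cover (g ` V) ((`) g ` E) C"
    using rt_graph_cover[OF H' H(2)] by blast
  then obtain D where D: "cover (g ` V) ((`) g ` E) D"
      "cover_number (g ` V) ((`) g ` E) = card D"
    using cover_number_attained[OF fin(2)] by blast
  define B where "B = {x \<in> V. g x \<in> D}"
  have DB: "D = g ` B"
    using D(1) by (auto simp: cover_def B_def)
  have inj: "inj_on g B"
    using g by (rule inj_on_subset) (auto simp: B_def)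
  have "cover V E B"
    unfolding cover_def
  proof (intro conjI ballI)
    fix e assume e: "e \<in> E"
    then have "D \<inter> g ` e \<noteq> {}" using D(1) by (auto simp: cover_def)
    then show "B \<inter> e \<noteq> {}" using e sub by (auto simp: B_def)
  qed (auto simp: B_def)
  then have "cover_number V E \<le> card B"
    using fin cover_number_le_card by blast
  also have "card B = card D"
    using inj by (simp add: DB card_image)
  finally show ?thesis using D by simp
qed

lemma cover_number_le_R:
  fixes V :: "'a set"
  assumes H: "rt_graph r t V E" and t: "1 \<le> t"
  shows "cover_number V E \<le> R r t"
proof -
  have "finite V"
    using H by (simp add: rt_graph_def hypergraph_def)
  then obtain g :: "'a \<Rightarrow> nat" where g: "inj_on g V"
    using finite_imp_inj_to_nat_seg by blast
  have "cover_number V E \<le> cover_number (g ` V) ((`) g ` E)"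
    using cover_number_image_ge[OF H t g] .
  also have "\<dots> \<le> R r t"
    unfolding R_def
    using finite_cover_numbers[OF t] rt_graph_image[OF H g] by (intro Max_ge) blast+
  finally show ?thesis .
qed

end

theory Submission
  imports Defs
begin

text \<open>
  Record an edge by its vertices in the \<open>r\<close> parts, so that \<open>t\<close>-intersecting means agreeing in at
  least \<open>t\<close> coordinates. If no \<open>K\<close> vertices form a cover, every choice of \<open>K\<close> vertices taken from a
  few edges is missed by some edge, and summing the agreements of that edge with the few given ones
  yields an inequality. For two edges with smallest intersection it gives the first two bounds.

  For the other two, write \<open>K = r - t - g\<close>. The inequality for two edges says that any two edges are
  either near (they differ in at most \<open>2g\<close> coordinates) or far (they agree in at most
  \<open>r - 3t + 1 + g\<close> coordinates). Fix an edge \<open>e\<close>. For every set \<open>A\<close> of \<open>t + g\<close> coordinates some edge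
  agrees with \<open>e\<close> only inside \<open>A\<close>. Moving \<open>A\<close> away from its initial position in steps of \<open>n\<close>
  coordinates, at some step the corresponding edge jumps from \<open>f\<close> to an edge \<open>h\<close> far from \<open>f\<close>. Then
  \<open>e, f, h\<close> have many coordinates in common, but at least \<open>n\<close> fewer than \<open>e, f\<close>, and for
  \<open>n = g + 1\<close> (third bound) or \<open>n = 2r - 10t + 3 + g\<close> (fourth bound) the inequality for three edges
  fails.
\<close>

section \<open>Edges as vectors of coordinates and their agreement sets\<close>

text \<open>A pair \<open>(e, j)\<close> names the vertex of \<open>e\<close> in part
  \<open>j\<close>. Counting pairs instead of vertices in \<open>avoid\<close> is harmless, since a
  vertex named twice only wastes budget.\<close>

locale uncovered_family =
  fixes I :: "'i set" and E :: "'e set" and \<phi> :: "'e \<Rightarrow> 'i \<Rightarrow> 'v" and t K :: nat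
  assumes finite_I: "finite I"
    and agree_ge: "\<And>e f. e \<in> E \<Longrightarrow> f \<in> E \<Longrightarrow> t \<le> card {j \<in> I. \<phi> e j = \<phi> f j}"
    and avoid: "\<And>S. S \<subseteq> E \<times> I \<Longrightarrow> card S \<le> K \<Longrightarrow> \<exists>h\<in>E. \<forall>(e, j)\<in>S. \<phi> h j \<noteq> \<phi> e j"
begin

definition agree :: "'e \<Rightarrow> 'e \<Rightarrow> 'i set" where
  "agree e f = {j \<in> I. \<phi> e j = \<phi> f j}"

lemma agree_subset: "agree e f \<subseteq> I"
  by (auto simp: agree_def)

lemma finite_agree [simp]: "finite (agree e f)"
  using agree_subset finite_I by (rule finite_subset)

lemma agree_self: "agree e e = I"
  by (auto simp: agree_def)

lemma card_agree_le: "card (agree e f) \<le> card I"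
  using agree_subset finite_I by (rule card_mono[rotated])

lemma t_le_agree: "e \<in> E \<Longrightarrow> f \<in> E \<Longrightarrow> t \<le> card (agree e f)"
  unfolding agree_def by (rule agree_ge)

lemma ex_edge: "\<exists>e. e \<in> E"
  using avoid[of "{}"] by auto

lemma agree_trans: "agree e f \<inter> agree f h \<subseteq> agree e h"
  by (auto simp: agree_def)

lemma card_agree_triangle: "card (agree e f) + card (agree f h) \<le> card I + card (agree e h)"
proof -
  have "card (agree e f) + card (agree f h)
      = card (agree e f \<union> agree f h) + card (agree e f \<inter> agree f h)"
    by (rule card_Un_Int) simp_all
  also have "\<dots> \<le> card I + card (agree e h)"
    using finite_I agree_subset agree_trans by (intro add_mono card_mono) auto
  finally show ?thesis .
qed

lemma reach:
  assumes "e \<in> E" "A \<subseteq> I" "card I \<le> K + card A"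
  obtains f where "f \<in> E" "agree e f \<subseteq> A"
proof -
  have "card ({e} \<times> (I - A)) \<le> K"
    using assms finite_I by (simp add: card_cartesian_product card_Diff_subset finite_subset)
  then obtain f where "f \<in> E" "\<forall>(e', j)\<in>{e} \<times> (I - A). \<phi> f j \<noteq> \<phi> e' j"
    using avoid[of "{e} \<times> (I - A)"] assms by auto
  then show ?thesis
    by (intro that[of f]) (auto simp: agree_def eq_commute)
qed

lemma K_le:
  assumes "1 \<le> t"
  shows "K + t \<le> card I"
proof (rule ccontr)
  assume "\<not> K + t \<le> card I"
  obtain e where e: "e \<in> E"
    using ex_edge by blast
  \<comment> \<open>If \<open>K\<close> exceeds \<open>card I\<close>, the difference is 0, which is
    still below \<open>t\<close> because \<open>1 \<le> t\<close>.\<close>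
  obtain A where A: "A \<subseteq> I" "card A = card I - K"
    by (metis diff_le_self obtain_subset_with_card_n)
  have "card I \<le> K + card A"
    using A(2) by simp
  then obtain f where f: "f \<in> E" "agree e f \<subseteq> A"
    using reach[OF e A(1)] by blast
  have "t \<le> card A"
    using t_le_agree[OF e f(1)] f(2) A(1) finite_I by (meson card_mono finite_subset le_trans)
  then show False
    using A(2) \<open>\<not> K + t \<le> card I\<close> assms by linarith
qed

section \<open>The inequality for two edges\<close>

text \<open>One vertex on a coordinate of \<open>P\<close> rules out agreement with both edges; a
  coordinate of \<open>Q\<close> takes two vertices and rules out only one agreement. The bound
  \<open>u\<close> is left free because \<open>closest_pair\<close> uses a value that may exceed
  \<open>t\<close>.\<close>

lemma two_edges:
  assumes "e \<in> E" "f \<in> E"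
    and u: "\<And>h k. h \<in> E \<Longrightarrow> k \<in> E \<Longrightarrow> u \<le> card (agree h k)"
    and p: "p \<le> card (agree e f)" and q: "q + card (agree e f) \<le> card I" and K: "p + 2 * q \<le> K"
  shows "2 * u + 2 * p + q \<le> card I + card (agree e f)"
proof -
  obtain P where P: "P \<subseteq> agree e f" "card P = p"
    using p by (meson obtain_subset_with_card_n)
  have "q \<le> card (I - agree e f)"
    using q finite_I agree_subset by (simp add: card_Diff_subset)
  then obtain Q where Q: "Q \<subseteq> I - agree e f" "card Q = q"
    by (meson obtain_subset_with_card_n)
  have fin: "finite P" "finite Q"
    using P Q finite_I by (meson finite_Diff finite_agree finite_subset)+
  let ?S = "{e} \<times> P \<union> {e, f} \<times> Q"
  have "card ?S \<le> card P + 2 * card Q"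
    using fin card_Un_le[of "{e} \<times> P" "{e, f} \<times> Q"]
    by (auto simp: card_cartesian_product card_insert_if split: if_splits)
  then have "card ?S \<le> K"
    using P Q K by simp
  moreover have "?S \<subseteq> E \<times> I"
    using P Q assms(1,2) agree_subset[of e f] by auto
  ultimately obtain h where h: "h \<in> E" "\<forall>(k, j)\<in>?S. \<phi> h j \<noteq> \<phi> k j"
    using avoid by meson
  have un: "agree h e \<union> agree h f \<subseteq> I - (P \<union> Q)"
  proof -
    have he: "\<phi> h j \<noteq> \<phi> e j" if "j \<in> P \<union> Q" for j
      using h(2) that by auto
    moreover have "\<phi> h j \<noteq> \<phi> f j" if "j \<in> P \<union> Q" for j
      using h(2) P(1) he[OF that] that by (auto simp: agree_def)
    ultimately show ?thesis
      by (auto simp: agree_def)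
  qed
  have int: "agree h e \<inter> agree h f \<subseteq> agree e f - P"
    using h(2) by (auto simp: agree_def)
  have "2 * u \<le> card (agree h e) + card (agree h f)"
    using u[OF h(1) assms(1)] u[OF h(1) assms(2)] by simp
  also have "\<dots> = card (agree h e \<union> agree h f) + card (agree h e \<inter> agree h f)"
    by (rule card_Un_Int) simp_all
  also have "\<dots> \<le> card (I - (P \<union> Q)) + card (agree e f - P)"
    using un int finite_I by (intro add_mono card_mono) auto
  also have "card (I - (P \<union> Q)) = card I - (p + q)"
  proof -
    have "P \<inter> Q = {}"
      using P Q by auto
    then have "card (P \<union> Q) = p + q"
      using P Q fin by (simp add: card_Un_disjoint)
    moreover have "P \<union> Q \<subseteq> I"
      using P Q agree_subset by blast
    ultimately show ?thesis
      using fin by (simp add: card_Diff_subset)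
  qed
  also have "card (agree e f - P) = card (agree e f) - p"
    using P fin by (simp add: card_Diff_subset)
  finally show ?thesis
    using p q by linarith
qed

text \<open>The budget \<open>K\<close> is spent first inside \<open>agree e f\<close>. If it ends
  there, the pair is near; otherwise the rest buys coordinates of disagreement at two vertices each,
  and rounding in this halving gives the \<open>+ 1\<close>.\<close>

lemma near_or_far:
  assumes "e \<in> E" "f \<in> E" and r: "card I = K + t + g"
  shows "card I \<le> card (agree e f) + 2 * g \<or> card (agree e f) + 3 * t \<le> card I + 1 + g"
proof (cases "K \<le> card (agree e f)")
  case True
  have "2 * t + 2 * K + 0 \<le> card I + card (agree e f)"
    using True card_agree_le by (intro two_edges[OF assms(1,2) t_le_agree]) auto
  then show ?thesis
    using r by linarith
next
  case False
  let ?q = "(K - card (agree e f)) div 2"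
  have "2 * t + 2 * card (agree e f) + ?q \<le> card I + card (agree e f)"
    using False r by (intro two_edges[OF assms(1,2) t_le_agree]) auto
  then show ?thesis
    using False r by linarith
qed

text \<open>For a pair with the fewest agreements \<open>s\<close>, \<open>two_edges\<close> applies
  with \<open>u = s\<close>. Each estimate takes the smallest \<open>p\<close> or \<open>q\<close>
  that would violate the inequality.\<close>

lemma closest_pair:
  assumes "1 \<le> t"
  shows "\<exists>s\<ge>t. (card I < 3 * s \<longrightarrow> K \<le> (card I - s) div 2) \<and>
                (3 * s \<le> card I \<longrightarrow> K + 5 * s < 2 * card I + 2)"
proof -
  define s where "s = (LEAST n. \<exists>e\<in>E. \<exists>f\<in>E. card (agree e f) = n)"
  have "\<exists>n. \<exists>e\<in>E. \<exists>f\<in>E. card (agree e f) = n"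
    using ex_edge by blast
  then have "\<exists>e\<in>E. \<exists>f\<in>E. card (agree e f) = s"
    unfolding s_def by (rule LeastI_ex)
  then obtain e f where ef: "e \<in> E" "f \<in> E" and s: "card (agree e f) = s"
    by blast
  have min: "s \<le> card (agree h k)" if "h \<in> E" "k \<in> E" for h k
    unfolding s_def using that by (intro Least_le) blast
  have s_le: "s \<le> card I"
    using card_agree_le[of e f] s by simp
  note two = two_edges[OF ef min, unfolded s]
  have "K \<le> (card I - s) div 2" if "card I < 3 * s"
  proof (rule ccontr)
    assume "\<not> K \<le> (card I - s) div 2"
    then have "2 * s + 2 * ((card I - s) div 2 + 1) + 0 \<le> card I + s"
      using that s_le by (intro two) auto
    moreover have "card I - s < 2 * ((card I - s) div 2 + 1)"
      by simp
    ultimately show False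
      using s_le by linarith
  qed
  moreover have "K + 5 * s < 2 * card I + 2" if "3 * s \<le> card I"
  proof (rule ccontr)
    assume "\<not> K + 5 * s < 2 * card I + 2"
    \<comment> \<open>Here \<open>p = s\<close> and \<open>q = card I + 1 - 3 * s\<close>; this
      \<open>q\<close> fits outside \<open>agree e f\<close> because
      \<open>s \<ge> 1\<close>.\<close>
    then have "2 * s + 2 * s + (card I + 1 - 3 * s) \<le> card I + s"
      using that t_le_agree[OF ef] s assms by (intro two) auto
    then show False
      using that by linarith
  qed
  ultimately show ?thesis
    using t_le_agree[OF ef] s by blast
qed

section \<open>The inequality for three edges\<close>

text \<open>
  Here \<open>w\<close> counts vertices spent on coordinates where exactly two of the edges agree. The shared
  vertex is always spent before the odd one, so each of the \<open>w\<close> vertices lowers the possible number of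
  agreements by one.
\<close>

lemma three_edges:
  assumes E: "e \<in> E" "f \<in> E" "h \<in> E"
  defines "A3 \<equiv> agree e f \<inter> agree e h"
    and "A2 \<equiv> (agree e f \<union> agree e h \<union> agree f h) - (agree e f \<inter> agree e h)"
    and "A1 \<equiv> I - (agree e f \<union> agree e h \<union> agree f h)"
  assumes w: "w \<le> 2 * card A2" and q: "q \<le> card A1" and K: "card A3 + w + 3 * q \<le> K"
  shows "3 * t + w + q \<le> 2 * card A2 + card A1"
proof -
  have fin: "finite A3" "finite A2" "finite A1"
    using finite_I by (auto simp: A1_def A2_def A3_def)
  obtain W1 where W1: "W1 \<subseteq> A2" "card W1 = min w (card A2)"
    by (metis min.cobounded2 obtain_subset_with_card_n)
  have "w - card A2 \<le> card W1"
    using w W1 by simp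
  then obtain W2 where W2: "W2 \<subseteq> W1" "card W2 = w - card A2"
    by (meson obtain_subset_with_card_n)
  obtain Q where Q: "Q \<subseteq> A1" "card Q = q"
    using q by (meson obtain_subset_with_card_n)
  have fin': "finite W1" "finite W2" "finite Q"
    using W1 W2 Q fin by (meson finite_subset)+
  define maj where "maj j = (if j \<in> agree e f \<or> j \<in> agree e h then e else f)" for j
  define mnr where "mnr j = (if j \<in> agree e f then h else if j \<in> agree e h then f else e)" for j
  let ?M = "(\<lambda>j. (maj j, j)) ` W1" and ?N = "(\<lambda>j. (mnr j, j)) ` W2"
  let ?S = "{e} \<times> A3 \<union> ?M \<union> ?N \<union> {e, f, h} \<times> Q"
  have "card ?S \<le> card ({e} \<times> A3) + card ?M + card ?N + card ({e, f, h} \<times> Q)"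
    by (meson card_Un_le add_le_mono1 le_trans)
  also have "\<dots> \<le> card A3 + card W1 + card W2 + 3 * card Q"
    using fin' by (intro add_mono card_image_le)
      (auto simp: card_cartesian_product card_insert_if)
  also have "\<dots> \<le> K"
    using K W1(2) W2(2) Q(2) by simp
  finally have "card ?S \<le> K" .
  moreover have "?S \<subseteq> E \<times> I"
    using E W1(1) W2(1) Q(1)
    by (auto simp: A1_def A2_def A3_def agree_def maj_def mnr_def)
  ultimately obtain k where k: "k \<in> E" "\<forall>(e', j)\<in>?S. \<phi> k j \<noteq> \<phi> e' j"
    using avoid by meson
  have card_sum: "card B = (\<Sum>j\<in>I. of_bool (j \<in> B))" if "B \<subseteq> I" for B
    using that finite_I by (simp add: Int_absorb1)
  have sub: "A2 - W1 \<subseteq> I" "A2 - W2 \<subseteq> I" "A1 - Q \<subseteq> I"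
    by (auto simp: A1_def A2_def agree_def)
  have "3 * t \<le> card (agree k e) + card (agree k f) + card (agree k h)"
    using t_le_agree[OF k(1) E(1)] t_le_agree[OF k(1) E(2)] t_le_agree[OF k(1) E(3)] by simp
  also have "\<dots> = (\<Sum>j\<in>I. of_bool (j \<in> agree k e) + of_bool (j \<in> agree k f) + of_bool (j \<in> agree k h))"
    by (simp only: card_sum[OF agree_subset] sum.distrib)
  \<comment> \<open>Coordinatewise, \<open>k\<close> agrees with none of the three edges on
    \<open>A3\<close>, with at most two on \<open>A2\<close> (one on \<open>W1\<close>, none on
    \<open>W2\<close>), and with at most one on \<open>A1\<close> (none on
    \<open>Q\<close>).\<close>
  also have "\<dots> \<le> (\<Sum>j\<in>I. of_bool (j \<in> A2 - W1) + of_bool (j \<in> A2 - W2) + of_bool (j \<in> A1 - Q))"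
  proof (rule sum_mono)
    fix j assume j: "j \<in> I"
    have "j \<in> A3 \<Longrightarrow> \<phi> k j \<noteq> \<phi> e j" "j \<in> W1 \<Longrightarrow> \<phi> k j \<noteq> \<phi> (maj j) j"
      "j \<in> W2 \<Longrightarrow> \<phi> k j \<noteq> \<phi> (mnr j) j"
      "j \<in> Q \<Longrightarrow> \<phi> k j \<noteq> \<phi> e j \<and> \<phi> k j \<noteq> \<phi> f j \<and> \<phi> k j \<noteq> \<phi> h j"
      using k(2) by auto
    then show "of_bool (j \<in> agree k e) + of_bool (j \<in> agree k f) + of_bool (j \<in> agree k h)
        \<le> (of_bool (j \<in> A2 - W1) + of_bool (j \<in> A2 - W2) + of_bool (j \<in> A1 - Q) :: nat)"
      using j W2(1) W1(1)
      by (auto simp: A1_def A2_def A3_def agree_def maj_def mnr_def split: if_splits)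
  qed
  also have "\<dots> = card (A2 - W1) + card (A2 - W2) + card (A1 - Q)"
    by (simp only: card_sum[OF sub(1)] card_sum[OF sub(2)] card_sum[OF sub(3)] sum.distrib)
  also have "\<dots> = (card A2 - card W1) + (card A2 - card W2) + (card A1 - card Q)"
    using W1(1) W2(1) Q(1) fin' by (simp add: card_Diff_subset)
  finally show ?thesis
    using w q W1(2) W2(2) Q(2) by (simp add: min_def split: if_splits)
qed

text \<open>Triple agreements count three times in \<open>s\<close>, so
  \<open>card A2 = s - 3 * x\<close> and \<open>card A1 = card I - s + 2 * x\<close>. Vertices are
  spent on \<open>A3\<close>, then \<open>A2\<close>, then \<open>A1\<close>; the first alternative
  arises when the budget ends within \<open>A2\<close>, the second, with rounding loss 2, when it
  reaches \<open>A1\<close>.\<close>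

lemma three_edges_card:
  assumes E: "e \<in> E" "f \<in> E" "h \<in> E"
  defines "x \<equiv> card (agree e f \<inter> agree e h)"
    and "s \<equiv> card (agree e f) + card (agree e h) + card (agree f h)"
  assumes x: "x \<le> K" and K: "K \<le> card I"
  shows "3 * t + 3 * x + K \<le> card I + s \<or> K + 9 * t + s \<le> 3 * card I + 2 + x"
proof -
  let ?A3 = "agree e f \<inter> agree e h"
  let ?A2 = "(agree e f \<union> agree e h \<union> agree f h) - (agree e f \<inter> agree e h)"
  let ?A1 = "I - (agree e f \<union> agree e h \<union> agree f h)"
  have card_sum: "card B = (\<Sum>j\<in>I. of_bool (j \<in> B))" if "B \<subseteq> I" for B
    using that finite_I by (simp add: Int_absorb1)
  have sub: "?A3 \<subseteq> I" "?A2 \<subseteq> I" "?A1 \<subseteq> I"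
    by (auto simp: agree_def)
  have s: "s = card ?A2 + (card ?A3 + card ?A3 + card ?A3)"
    unfolding s_def card_sum[OF sub(1)] card_sum[OF sub(2)] card_sum[OF agree_subset]
      sum.distrib[symmetric]
    by (rule sum.cong) (auto simp: agree_def)
  have r: "card I = card ?A3 + card ?A2 + card ?A1"
    unfolding card_sum[OF sub(1)] card_sum[OF sub(2)] card_sum[OF sub(3)] card_sum[OF subset_refl]
      sum.distrib[symmetric]
    by (rule sum.cong) (auto simp: agree_def)
  note three = three_edges[OF E]
  show ?thesis
  proof (cases "K \<le> x + 2 * card ?A2")
    case True
    have "3 * t + (K - x) + 0 \<le> 2 * card ?A2 + card ?A1"
      using True x by (intro three) (auto simp: x_def)
    then show ?thesis
      using x s r unfolding x_def by linarith
  next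
    case False
    let ?q = "(K - x - 2 * card ?A2) div 3"
    have "3 * t + 2 * card ?A2 + ?q \<le> 2 * card ?A2 + card ?A1"
    proof (intro three)
      show "?q \<le> card ?A1"
        using K r unfolding x_def by linarith
      show "card ?A3 + 2 * card ?A2 + 3 * ?q \<le> K"
        using False unfolding x_def by linarith
    qed simp
    then show ?thesis
      using False s r unfolding x_def by linarith
  qed
qed

section \<open>Two far edges with large common agreement with a third\<close>

text \<open>Minimality replaces the stepwise motion of \<open>A\<close>: among good pairs with
  \<open>f\<close> near \<open>f0\<close>, one with least \<open>card (A \<inter> T)\<close> is
  taken. Exchanging \<open>n\<close> coordinates of \<open>T\<close> for new ones lowers this
  number, so the resulting \<open>h\<close> cannot be near \<open>f0\<close>.\<close>

lemma far_pair:
  assumes r: "card I = K + t + g" and n: "1 \<le> n" "2 * g + n \<le> t" "2 * t + 2 * g + n \<le> card I"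
    and g: "5 * g + 1 < 3 * t" and e: "e \<in> E"
  obtains f h where "f \<in> E" "h \<in> E" "card (agree e f) \<le> t + g"
    "card (agree e f) + card (agree e h) \<le> card (agree e f \<inter> agree e h) + t + g + n"
    "card (agree e f \<inter> agree e h) + n \<le> card (agree e f)"
    "card (agree f h) + 3 * t \<le> card I + 1 + g"
proof -
  define near where "near f h \<longleftrightarrow> card I \<le> card (agree f h) + 2 * g" for f h
  define good where "good A f \<longleftrightarrow> A \<subseteq> I \<and> card A = t + g \<and> f \<in> E \<and> agree e f \<subseteq> A" for A f
  have ex_good: "\<exists>f. good A f" if "A \<subseteq> I" "card A = t + g" for A
    using that r reach[OF e that(1)] unfolding good_def by (metis add.assoc le_refl)
  have "t + g \<le> card I"
    using r by simp
  then obtain A0 f0 where A0: "good A0 f0"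
    using ex_good by (meson obtain_subset_with_card_n)
  define T where "T = agree e f0"
  have T: "T \<subseteq> A0" "A0 \<subseteq> I" "card A0 = t + g" "f0 \<in> E"
    using A0 by (auto simp: good_def T_def)
  have finT: "finite T" "card T \<le> t + g" "t \<le> card T"
    using T finite_I t_le_agree[OF e T(4)] card_mono[of A0 T] finite_subset[of A0 I]
    by (auto simp: T_def)
  define P where "P m \<longleftrightarrow> (\<exists>A f. good A f \<and> near f0 f \<and> card (A \<inter> T) = m)" for m
  have "near f0 f0"
    by (simp add: near_def agree_self)
  then have "P (card (A0 \<inter> T))"
    using A0 P_def by blast
  then have "P (Least P)"
    by (rule LeastI)
  then obtain A f where A: "good A f" "near f0 f" "card (A \<inter> T) = Least P"
    unfolding P_def[of "Least P"] by blast
  have A': "A \<subseteq> I" "card A = t + g" "f \<in> E" "agree e f \<subseteq> A" "finite A"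
    using A(1) finite_I by (auto simp: good_def intro: finite_subset)
  \<comment> \<open>As \<open>f\<close> differs from \<open>f0\<close> in at most
    \<open>2 * g\<close> coordinates, at least \<open>t - 2 * g\<close> coordinates of
    \<open>T\<close> survive in \<open>agree e f\<close>.\<close>
  have "n \<le> card (agree e f \<inter> T)"
  proof -
    have "card T + card (agree f0 f) = card (T \<union> agree f0 f) + card (T \<inter> agree f0 f)"
      using finT by (intro card_Un_Int) simp_all
    moreover have "card (T \<union> agree f0 f) \<le> card I"
      using T agree_subset finite_I by (intro card_mono) auto
    moreover have "card (T \<inter> agree f0 f) \<le> card (agree e f \<inter> T)"
      using agree_trans[of e f0 f] finT by (intro card_mono) (auto simp: T_def)
    ultimately show ?thesis
      using A(2) finT n(2) by (simp add: near_def)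
  qed
  then obtain B where B: "B \<subseteq> agree e f \<inter> T" "card B = n"
    by (meson obtain_subset_with_card_n)
  have "n \<le> card (I - (A \<union> T))"
  proof -
    have "card (I - (A \<union> T)) = card I - card (A \<union> T)"
      using A' T finT by (intro card_Diff_subset) auto
    moreover have "card (A \<union> T) \<le> card A + card T"
      by (rule card_Un_le)
    ultimately show ?thesis
      using A' finT n(3) by linarith
  qed
  then obtain N where N: "N \<subseteq> I - (A \<union> T)" "card N = n"
    by (meson obtain_subset_with_card_n)
  have fin: "finite B" "finite N"
    using B N n(1) by (auto intro: card_ge_0_finite)
  have BA: "B \<subseteq> A"
    using B A' by auto
  have "card (A - B \<union> N) = card (A - B) + card N"
    using A' fin N by (intro card_Un_disjoint) auto
  moreover have "card (A - B) = card A - card B"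
    using BA fin by (simp add: card_Diff_subset)
  moreover have "card B \<le> card A"
    using BA A'(5) by (metis card_mono)
  ultimately have cAN: "card (A - B \<union> N) = t + g"
    using A' B N by simp
  moreover have "A - B \<union> N \<subseteq> I"
    using A' N by auto
  ultimately obtain h where h: "good (A - B \<union> N) h"
    using ex_good by blast
  have hE: "h \<in> E" and eh: "agree e h \<subseteq> A - B \<union> N"
    using h by (auto simp: good_def)
  have "\<not> near f0 h"
  proof
    assume "near f0 h"
    then have "Least P \<le> card ((A - B \<union> N) \<inter> T)"
      using h P_def by (intro Least_le) blast
    moreover have "card ((A - B \<union> N) \<inter> T) < card (A \<inter> T)"
    proof (rule psubset_card_mono)
      obtain b where "b \<in> B"
        using B n(1) by (metis One_nat_def Suc_n_not_le_n card.empty equals0I)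
      then show "(A - B \<union> N) \<inter> T \<subset> A \<inter> T"
        using B BA N by blast
    qed (use A' in auto)
    ultimately show False
      using A(3) by simp
  qed
  \<comment> \<open>Otherwise \<open>f0\<close> and \<open>h\<close> would agree in at least
    \<open>card I - 4 * g\<close> coordinates, too many for a far pair when
    \<open>5 * g + 1 < 3 * t\<close>.\<close>
  have "\<not> near f h"
  proof
    assume "near f h"
    then have "card I \<le> card (agree f0 h) + 4 * g"
      using card_agree_triangle[of f0 f h] A(2) by (simp add: near_def)
    then show False
      using near_or_far[OF T(4) hE r] \<open>\<not> near f0 h\<close> g by (simp add: near_def)
  qed
  show ?thesis
  proof (rule that[OF A'(3) hE])
    show "card (agree e f) \<le> t + g"
      using A' by (metis card_mono)
    have "card (agree e f) + card (agree e h)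
        = card (agree e f \<union> agree e h) + card (agree e f \<inter> agree e h)"
      by (rule card_Un_Int) simp_all
    moreover have "card (agree e f \<union> agree e h) \<le> card (A \<union> N)"
      using A' eh fin by (intro card_mono) auto
    moreover have "card (A \<union> N) \<le> card A + card N"
      by (rule card_Un_le)
    ultimately show "card (agree e f) + card (agree e h)
        \<le> card (agree e f \<inter> agree e h) + t + g + n"
      using A' N by simp
    have "card (agree e f \<inter> agree e h) \<le> card (agree e f - B)"
      using eh B N BA A' by (intro card_mono) auto
    also have "\<dots> = card (agree e f) - n"
      using B fin by (simp add: card_Diff_subset)
    finally show "card (agree e f \<inter> agree e h) + n \<le> card (agree e f)"
      using B card_mono[of "agree e f" B] by simp
    show "card (agree f h) + 3 * t \<le> card I + 1 + g"
      using near_or_far[OF A'(3) hE r] \<open>\<not> near f h\<close> by (simp add: near_def)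
  qed
qed

text \<open>Let \<open>x\<close> be the number of common agreements from \<open>far_pair\<close>.
  Then \<open>x \<ge> t - g - n\<close>, so \<open>n_le\<close> refutes the first alternative of
  \<open>three_edges_card\<close>; the total of pairwise agreements is at least
  \<open>x + n + 2 * t\<close>, so \<open>n_ge\<close> refutes the second.\<close>

lemma three_edges_contradiction:
  assumes r: "card I = K + t + g" and n: "1 \<le> n" "2 * g + n \<le> t" "2 * t + 2 * g + n \<le> card I"
    and g: "5 * g + 1 < 3 * t"
    and n_ge: "2 * card I + 3 + g \<le> 10 * t + n" and n_le: "5 * g + 3 * n + card I + 2 \<le> 6 * t"
  shows False
proof -
  obtain e where e: "e \<in> E"
    using ex_edge by blast
  obtain f h where fh: "f \<in> E" "h \<in> E" and s: "card (agree e f) \<le> t + g"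
    "card (agree e f) + card (agree e h) \<le> card (agree e f \<inter> agree e h) + t + g + n"
    "card (agree e f \<inter> agree e h) + n \<le> card (agree e f)"
    "card (agree f h) + 3 * t \<le> card I + 1 + g"
    using far_pair[OF r n g e] by blast
  note ge = t_le_agree[OF e fh(1)] t_le_agree[OF e fh(2)] t_le_agree[OF fh]
  have "card (agree e f \<inter> agree e h) \<le> K"
    using s(1,3) n(3) r by linarith
  from three_edges_card[OF e fh this] show False
    using r s ge n_ge n_le by linarith
qed

end

section \<open>From hypergraphs to coordinates, and the four bounds\<close>

text \<open>Each edge has one vertex per part, and a common vertex of two edges lies in a single
  part, so it gives a coordinate of agreement. Any \<open>K\<close> vertices fail to cover, which
  yields \<open>avoid\<close>.\<close>

lemma uncovered_family_if_less_cover_number: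
  fixes V :: "'a set"
  assumes H: "rt_graph r t V E" and K: "K < cover_number V E"
  shows "\<exists>\<phi> :: 'a set \<Rightarrow> nat \<Rightarrow> 'a. uncovered_family {1..r} E \<phi> t K"
proof -
  obtain P where P: "V = (\<Union>j\<in>{1..r}. P j)"
      "\<And>e j. e \<in> E \<Longrightarrow> j \<in> {1..r} \<Longrightarrow> card (e \<inter> P j) = 1"
    using H by (auto simp: rt_graph_def partite_def)
  have V: "finite V" and sub: "\<And>e. e \<in> E \<Longrightarrow> e \<subseteq> V"
    and t: "\<And>e f. e \<in> E \<Longrightarrow> f \<in> E \<Longrightarrow> t \<le> card (e \<inter> f)"
    using H by (auto simp: rt_graph_def hypergraph_def t_intersecting_def)
  define \<phi> where "\<phi> e j = the_elem (e \<inter> P j)" for e j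
  have \<phi>: "e \<inter> P j = {\<phi> e j}" if "e \<in> E" "j \<in> {1..r}" for e j
    using P(2)[OF that] by (metis \<phi>_def card_1_singletonE the_elem_eq)
  have "uncovered_family {1..r} E \<phi> t K"
  proof
    fix e f assume ef: "e \<in> E" "f \<in> E"
    have "e \<inter> f \<subseteq> \<phi> e ` {j \<in> {1..r}. \<phi> e j = \<phi> f j}"
    proof
      fix v assume v: "v \<in> e \<inter> f"
      then obtain j where j: "j \<in> {1..r}" "v \<in> P j"
        using sub[OF ef(1)] P(1) by auto
      have "v = \<phi> e j" "v = \<phi> f j"
        using \<phi>[OF ef(1) j(1)] \<phi>[OF ef(2) j(1)] v j(2) by blast+
      then show "v \<in> \<phi> e ` {j \<in> {1..r}. \<phi> e j = \<phi> f j}"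
        using j(1) by (intro image_eqI[of _ _ j]) auto
    qed
    then have "card (e \<inter> f) \<le> card {j \<in> {1..r}. \<phi> e j = \<phi> f j}"
      by (rule surj_card_le[rotated]) simp
    then show "t \<le> card {j \<in> {1..r}. \<phi> e j = \<phi> f j}"
      using t[OF ef] by simp
  next
    fix S assume S: "S \<subseteq> E \<times> {1..r}" "card S \<le> K"
    let ?C = "(\<lambda>(e, j). \<phi> e j) ` S"
    have "finite E"
      using V sub by (meson PowI finite_Pow_iff finite_subset subsetI)
    then have "finite S"
      using S(1) by (meson finite_SigmaI finite_atLeastAtMost finite_subset)
    then have "card ?C < cover_number V E"
      using S(2) K by (meson card_image_le le_trans not_le)
    then have "\<not> cover V E ?C"
      using cover_number_le_card[OF V] by (meson not_le)
    moreover have "?C \<subseteq> V"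
      using S(1) \<phi> sub by fastforce
    ultimately obtain h where h: "h \<in> E" "?C \<inter> h = {}"
      by (auto simp: cover_def)
    have "\<phi> h j \<noteq> \<phi> e j" if "(e, j) \<in> S" for e j
    proof -
      have "\<phi> h j \<in> h"
        using \<phi>[OF h(1), of j] S(1) that by fastforce
      moreover have "\<phi> e j \<in> ?C"
        using that by force
      ultimately show ?thesis
        using h(2) by auto
    qed
    then show "\<exists>h\<in>E. \<forall>(e, j)\<in>S. \<phi> h j \<noteq> \<phi> e j"
      using h(1) by blast
  qed simp
  then show ?thesis
    by (rule exI[where x = \<phi>])
qed

theorem theorem1p5:
  fixes r t :: nat
  assumes "1 \<le> t" and "t \<le> r"
  shows "(real r \<le> 3 * real t - 1 \<longrightarrow>
            int (R r t) \<le> \<lfloor>(real r - real t) / 2\<rfloor> + 1)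
       \<and> (3 * real t \<le> real r \<and> real r \<le> 26 * real t / 7 \<longrightarrow>
            int (R r t) \<le> 2 * int r - 5 * int t + 2)
       \<and> (26 * real t / 7 \<le> real r \<and> real r \<le> 5 * real t - 2 \<longrightarrow>
            int (R r t) \<le> \<lfloor>(9 * real r - 14 * real t) / 8\<rfloor> + 2)
       \<and> (5 * real t - 1 \<le> real r \<and> real r \<le> (52 * real t - 13) / 9 \<longrightarrow>
            int (R r t) \<le> \<lfloor>(15 * real r - 44 * real t) / 8\<rfloor> + 3)"
proof (cases "R r t = 0")
  \<comment> \<open>This case is separate so that \<open>K = R r t - 1\<close> is not truncated; all
    four right-hand sides are nonnegative in their ranges.\<close>
  case True
  show ?thesis
    using assms unfolding True by (simp add: le_floor_iff field_simps)
next
  case False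
  obtain V :: "nat set" and E where H: "rt_graph r t V E" "R r t = cover_number V E"
    using R_attained[OF assms(1)] .
  define K where "K = R r t - 1"
  have K: "R r t = K + 1"
    using False by (simp add: K_def)
  have "K < cover_number V E"
    using H(2) K by simp
  then obtain \<phi> :: "nat set \<Rightarrow> nat \<Rightarrow> nat" where "uncovered_family {1..r} E \<phi> t K"
    using uncovered_family_if_less_cover_number[OF H(1)] by blast
  then interpret uncovered_family "{1..r}" E \<phi> t K .
  define g where "g = r - t - K"
  have g: "r = K + t + g"
    using K_le[OF assms(1)] by (simp add: g_def)
  note no = three_edges_contradiction[unfolded card_atLeastAtMost diff_Suc_1, OF g]
  obtain s where s: "t \<le> s" "r < 3 * s \<longrightarrow> K \<le> (r - s) div 2"
    "3 * s \<le> r \<longrightarrow> K + 5 * s < 2 * r + 2"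
    using closest_pair[OF assms(1)] by auto
  have "int (R r t) \<le> \<lfloor>(real r - real t) / 2\<rfloor> + 1" if "real r \<le> 3 * real t - 1"
  proof -
    have "r < 3 * s"
      using that s(1) by linarith
    then have "2 * K + t \<le> r"
      using s assms by linarith
    then show ?thesis
      unfolding K by (simp add: le_floor_iff field_simps)
  qed
  \<comment> \<open>If \<open>r < 3 * s\<close>, then
    \<open>K \<le> r / 3 \<le> 2 * r - 5 * t\<close>; otherwise the second estimate for
    \<open>s \<ge> t\<close> applies.\<close>
  moreover have "int (R r t) \<le> 2 * int r - 5 * int t + 2" if "3 * real t \<le> real r"
    using that s assms unfolding K by linarith
  moreover have "int (R r t) \<le> \<lfloor>(9 * real r - 14 * real t) / 8\<rfloor> + 2"
    if "26 * real t / 7 \<le> real r" "real r \<le> 5 * real t - 2"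
  proof -
    have b: "26 * t \<le> 7 * r" "r + 2 \<le> 5 * t"
      using that by linarith+
    \<comment> \<open>Since \<open>g = r - t - K\<close>, this says
      \<open>8 * K + 14 * t \<le> 9 * r + 8\<close>.\<close>
    have "6 * t \<le> 8 * g + r + 8"
    proof (rule ccontr)
      assume "\<not> 6 * t \<le> 8 * g + r + 8"
      then have c: "8 * g + r + 9 \<le> 6 * t"
        by simp
      show False
        using b c by (intro no[of "g + 1"]) (linarith | simp)+
    qed
    then have "real (8 * K + 14 * t) \<le> real (9 * r + 8)"
      unfolding of_nat_le_iff using g by linarith
    then have "real_of_int (int K - 1) \<le> (9 * real r - 14 * real t) / 8"
      by simp
    then have "int K - 1 \<le> \<lfloor>(9 * real r - 14 * real t) / 8\<rfloor>"
      by (simp only: le_floor_iff)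
    then show ?thesis
      unfolding K by simp
  qed
  moreover have "int (R r t) \<le> \<lfloor>(15 * real r - 44 * real t) / 8\<rfloor> + 3"
    if "5 * real t - 1 \<le> real r"
  proof -
    have b: "5 * t \<le> r + 1"
      using that by linarith
    have "36 * t \<le> 8 * g + 7 * r + 16"
    proof (rule ccontr)
      assume "\<not> 36 * t \<le> 8 * g + 7 * r + 16"
      then have c: "8 * g + 7 * r + 17 \<le> 36 * t"
        by simp
      \<comment> \<open>This is the smallest \<open>n\<close> allowed by \<open>n_ge\<close>; it is
        at least \<open>g + 1\<close>, with equality at \<open>r = 5 * t - 1\<close>.\<close>
      show False
        using b c by (intro no[of "2 * r + 3 + g - 10 * t"]) (linarith | simp)+
    qed
    then have "real (8 * K + 44 * t) \<le> real (15 * r + 16)"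
      unfolding of_nat_le_iff using g by linarith
    then have "real_of_int (int K - 2) \<le> (15 * real r - 44 * real t) / 8"
      by simp
    then have "int K - 2 \<le> \<lfloor>(15 * real r - 44 * real t) / 8\<rfloor>"
      by (simp only: le_floor_iff)
    then show ?thesis
      unfolding K by simp
  qed
  ultimately show ?thesis
    by blast
qed

end
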